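(* Let $M$ be a relational Fraïssé structure with strong amalgamation. Then the following are equivalent: (i) $M$ has the infinite sunflower property; (ii) $M$ has the infinite $2$-sunflower property; (iii) $M$ has the canonical infinite point-Ramsey property.
   Context: A Fraïssé structure is a countably infinite ultrahomogeneous first-order structure (each isomorphism between finitely generated substructures extends to an automorphism); it is relational if its language is relational. The age $\mathrm{Age}(M)$ is the class of finite structures embeddable in $M$. $M$ has strong amalgamation if for all pairs of embeddings $B_0 \leftarrow A \rightarrow B_1$ in $\mathrm{Age}(M)$ there is an amalgam $B_0 \rightarrow C \leftarrow B_1$ in $\mathrm{Age}(M)$ (the two composite embeddings $A \to C$ agree) such that the images of $B_0$ and $B_1$ in $C$ intersect exactly in the image of $A$. A copy of $M$ in a structure is a substructure isomorphic to $M$. For $k \in \mathbb{N}_+$, a $k$-set is a set of size $k$. A structure on $k$-sets is a first-order structure each element of whose domain is a $k$-set. A structure $S$ on $k$-sets is a structured sunflower if there is a set $c$ with $v \cap v' = c$ for all distinct $v, v' \in S$. An infinite structure $M$ has the infinite $k$-sunflower property if each structure on $k$-sets $M'$ with $M' \cong M$ contains (as a substructure) a structured sunflower $S \cong M$. $M$ has the infinite sunflower property if it has the infinite $k$-sunflower property for all $k \in \mathbb{N}_+$. $M$ has the canonical infinite point-Ramsey property if for each colouring $\chi : M \to \omega$ of the elements of $M$ there is a copy of $M$ in $M$ which is monochromatic (all elements have the same colour) or heterochromatic (all elements have pairwise different colours). *)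

theory Defs
  imports
    "HOL-Library.Countable_Set"
    "HOL-Library.Infinite_Typeclass"
begin

record 'r language =
  symbols :: "'r set"
  arity :: "'r \<Rightarrow> nat"

text \<open>
  Only the interpretations of the symbols of the language matter, so every notion below
  quantifies over \<open>symbols L\<close>. An \<open>n\<close>-tuple is a list of length \<open>n\<close>.
\<close>

record ('a, 'r) rel_structure =
  universe :: "'a set"
  interp :: "'r \<Rightarrow> 'a list set"

definition is_structure :: "'r language \<Rightarrow> ('a, 'r) rel_structure \<Rightarrow> bool" where
  "is_structure L M \<longleftrightarrow>
     (\<forall>R\<in>symbols L. \<forall>xs\<in>interp M R. length xs = arity L R \<and> xs \<in> lists (universe M))"

definition embedding ::
    "'r language \<Rightarrow> ('a \<Rightarrow> 'b) \<Rightarrow> ('a, 'r) rel_structure \<Rightarrow> ('b, 'r) rel_structure \<Rightarrow> bool" where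
  "embedding L f A B \<longleftrightarrow>
     f ` universe A \<subseteq> universe B \<and> inj_on f (universe A) \<and>
     (\<forall>R\<in>symbols L. \<forall>xs\<in>lists (universe A). length xs = arity L R \<longrightarrow>
        (xs \<in> interp A R \<longleftrightarrow> map f xs \<in> interp B R))"

definition isomorphism ::
    "'r language \<Rightarrow> ('a \<Rightarrow> 'b) \<Rightarrow> ('a, 'r) rel_structure \<Rightarrow> ('b, 'r) rel_structure \<Rightarrow> bool" where
  "isomorphism L f A B \<longleftrightarrow> embedding L f A B \<and> f ` universe A = universe B"

definition isomorphic ::
    "'r language \<Rightarrow> ('a, 'r) rel_structure \<Rightarrow> ('b, 'r) rel_structure \<Rightarrow> bool" where
  "isomorphic L A B \<longleftrightarrow> (\<exists>f. isomorphism L f A B)"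

definition substructure ::
    "'r language \<Rightarrow> ('a, 'r) rel_structure \<Rightarrow> ('a, 'r) rel_structure \<Rightarrow> bool" where
  "substructure L S M \<longleftrightarrow>
     universe S \<subseteq> universe M \<and>
     (\<forall>R\<in>symbols L. interp S R = interp M R \<inter> lists (universe S))"

text \<open>In a relational language the finitely generated substructures are the finite ones.\<close>

definition ultrahomogeneous :: "'r language \<Rightarrow> ('a, 'r) rel_structure \<Rightarrow> bool" where
  "ultrahomogeneous L M \<longleftrightarrow>
     (\<forall>A B f. substructure L A M \<and> finite (universe A) \<and>
              substructure L B M \<and> finite (universe B) \<and> isomorphism L f A B \<longrightarrow>
        (\<exists>g. isomorphism L g M M \<and> (\<forall>x\<in>universe A. g x = f x)))"

definition relational_fraisse_structure :: "'r language \<Rightarrow> ('a, 'r) rel_structure \<Rightarrow> bool" where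
  "relational_fraisse_structure L M \<longleftrightarrow>
     is_structure L M \<and> countable (universe M) \<and> infinite (universe M) \<and> ultrahomogeneous L M"

text \<open>
  The age is closed under isomorphism and consists of finite structures, so it is represented
  by its members whose universe is a set of natural numbers. The empty structure is included.
\<close>

definition age :: "'r language \<Rightarrow> ('a, 'r) rel_structure \<Rightarrow> (nat, 'r) rel_structure set" where
  "age L M = {A. is_structure L A \<and> finite (universe A) \<and> (\<exists>f. embedding L f A M)}"

definition strong_amalgamation :: "'r language \<Rightarrow> ('a, 'r) rel_structure \<Rightarrow> bool" where
  "strong_amalgamation L M \<longleftrightarrow>
     (\<forall>A\<in>age L M. \<forall>B0\<in>age L M. \<forall>B1\<in>age L M. \<forall>f0 f1.
        embedding L f0 A B0 \<and> embedding L f1 A B1 \<longrightarrow>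
        (\<exists>C\<in>age L M. \<exists>g0 g1.
           embedding L g0 B0 C \<and> embedding L g1 B1 C \<and>
           (\<forall>x\<in>universe A. g0 (f0 x) = g1 (f1 x)) \<and>
           g0 ` universe B0 \<inter> g1 ` universe B1 = (g0 \<circ> f0) ` universe A))"

definition structure_on_sets :: "nat \<Rightarrow> ('u set, 'r) rel_structure \<Rightarrow> bool" where
  "structure_on_sets k S \<longleftrightarrow> (\<forall>v\<in>universe S. finite v \<and> card v = k)"

definition structured_sunflower :: "('u set, 'r) rel_structure \<Rightarrow> bool" where
  "structured_sunflower S \<longleftrightarrow>
     (\<exists>c. \<forall>v\<in>universe S. \<forall>v'\<in>universe S. v \<noteq> v' \<longrightarrow> v \<inter> v' = c)"

text \<open>
  The type \<open>'u\<close> supplies the points of which the \<open>k\<close>-sets consist. For countable \<open>M\<close> only countably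
  many points occur in a structure on \<open>k\<close>-sets isomorphic to \<open>M\<close>, so every infinite type \<open>'u\<close>
  gives the same notion.
\<close>

definition infinite_k_sunflower_property ::
    "'u::infinite itself \<Rightarrow> nat \<Rightarrow> 'r language \<Rightarrow> ('a, 'r) rel_structure \<Rightarrow> bool" where
  "infinite_k_sunflower_property U k L M \<longleftrightarrow>
     (\<forall>M' :: ('u set, 'r) rel_structure.
        is_structure L M' \<and> structure_on_sets k M' \<and> isomorphic L M' M \<longrightarrow>
        (\<exists>S. substructure L S M' \<and> structured_sunflower S \<and> isomorphic L S M))"

definition infinite_sunflower_property ::
    "'u::infinite itself \<Rightarrow> 'r language \<Rightarrow> ('a, 'r) rel_structure \<Rightarrow> bool" where
  "infinite_sunflower_property U L M \<longleftrightarrow> (\<forall>k\<ge>1. infinite_k_sunflower_property U k L M)"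

definition canonical_infinite_point_ramsey ::
    "'r language \<Rightarrow> ('a, 'r) rel_structure \<Rightarrow> bool" where
  "canonical_infinite_point_ramsey L M \<longleftrightarrow>
     (\<forall>\<chi> :: 'a \<Rightarrow> nat. \<exists>N. substructure L N M \<and> isomorphic L N M \<and>
        ((\<exists>c. \<forall>x\<in>universe N. \<chi> x = c) \<or> inj_on \<chi> (universe N)))"

end

theory Submission
  imports Defs
begin

text \<open>
  For the implication from the 2-sunflower property to the point-Ramsey property, code a point
  \<open>x\<close> of colour \<open>\<chi> x\<close> by the pair \<open>{x, \<chi> x}\<close>: a nonempty kernel is a common colour, and an empty
  kernel means that all colours differ.

  For the converse, list each \<open>k\<close>-set as \<open>d\<^sub>0 x, \<dots>, d\<^sub>k\<^sub>-\<^sub>1 x\<close>. By \<open>k\<close> applications of the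
  point-Ramsey property we may assume that every \<open>d\<^sub>j\<close> is constant or injective. The constant
  values form the kernel, and since the other \<open>d\<^sub>j\<close> are injective, each \<open>k\<close>-set meets only finitely
  many others outside the kernel. By strong amalgamation every one-point extension of a finite
  substructure is realised outside any given finite set, so a copy of \<open>M\<close> can be built point by
  point while avoiding these finitely many conflicts.
\<close>

section \<open>Restrictions and images of structures, embeddings and isomorphisms\<close>

definition restrict_structure :: "('a, 'r) rel_structure \<Rightarrow> 'a set \<Rightarrow> ('a, 'r) rel_structure" where
  "restrict_structure M X = \<lparr>universe = X, interp = (\<lambda>R. interp M R \<inter> lists X)\<rparr>"

definition image_structure ::
    "('a \<Rightarrow> 'b) \<Rightarrow> ('a, 'r) rel_structure \<Rightarrow> ('b, 'r) rel_structure" where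
  "image_structure f M = \<lparr>universe = f ` universe M, interp = (\<lambda>R. map f ` interp M R)\<rparr>"

lemma universe_restrict_structure [simp]: "universe (restrict_structure M X) = X"
  by (simp add: restrict_structure_def)

lemma universe_image_structure [simp]: "universe (image_structure f M) = f ` universe M"
  by (simp add: image_structure_def)

lemma substructure_restrict:
  "X \<subseteq> universe M \<Longrightarrow> substructure L (restrict_structure M X) M"
  by (simp add: substructure_def restrict_structure_def)

lemma is_structure_restrict:
  "is_structure L M \<Longrightarrow> is_structure L (restrict_structure M X)"
  by (auto simp: is_structure_def restrict_structure_def)

lemma embedding_id: "embedding L id M M"
  by (simp add: embedding_def)

lemma embedding_comp:
  assumes "embedding L f A B" and "embedding L g B C"
  shows "embedding L (g \<circ> f) A C"
proof -
  have "map f xs \<in> lists (universe B)" if "xs \<in> lists (universe A)" for xs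
    using assms(1) that unfolding embedding_def by (simp add: image_subset_iff in_lists_conv_set)
  moreover have "inj_on (g \<circ> f) (universe A)"
    using assms unfolding embedding_def by (meson comp_inj_on inj_on_subset)
  ultimately show ?thesis
    using assms unfolding embedding_def by (simp add: image_subset_iff)
qed

lemma embedding_cong:
  assumes "embedding L f A B" and "\<And>x. x \<in> universe A \<Longrightarrow> f x = g x"
  shows "embedding L g A B"
proof -
  have "map f xs \<in> interp B R \<longleftrightarrow> map g xs \<in> interp B R" if "xs \<in> lists (universe A)" for xs R
    using assms(2) that by (metis in_listsD map_cong)
  moreover have "f ` universe A = g ` universe A"
    using assms(2) by auto
  moreover have "inj_on f (universe A) = inj_on g (universe A)"
    using assms(2) by (rule inj_on_cong)
  ultimately show ?thesis
    using assms(1) unfolding embedding_def by simp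
qed

lemma embedding_substructure: "substructure L S M \<Longrightarrow> embedding L id S M"
  by (auto simp: substructure_def embedding_def)

lemma embedding_restrict:
  assumes "embedding L f A B" and "X \<subseteq> universe A"
  shows "embedding L f (restrict_structure A X) B"
  using embedding_comp[OF embedding_substructure[OF substructure_restrict[OF assms(2)]] assms(1)]
  by simp

lemma isomorphism_onto_image:
  assumes "embedding L f A B"
  shows "isomorphism L f A (restrict_structure B (f ` universe A))"
  using assms unfolding isomorphism_def embedding_def restrict_structure_def by auto

lemma isomorphism_inv:
  assumes "isomorphism L f A B"
  shows "isomorphism L (inv_into (universe A) f) B A"
proof -
  let ?g = "inv_into (universe A) f"
  have inj: "inj_on f (universe A)" and im: "f ` universe A = universe B"
    using assms by (auto simp: isomorphism_def embedding_def)
  have "xs \<in> interp B R \<longleftrightarrow> map ?g xs \<in> interp A R"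
    if "R \<in> symbols L" "xs \<in> lists (universe B)" "length xs = arity L R" for R xs
  proof -
    have "map ?g xs \<in> lists (universe A)"
      using that(2) im by (simp add: in_lists_conv_set inv_into_into)
    moreover have "map f (map ?g xs) = xs"
      using that(2) im by (auto simp: f_inv_into_f intro!: map_idI)
    ultimately show ?thesis
      using assms that unfolding isomorphism_def embedding_def by (metis length_map)
  qed
  moreover have "?g ` universe B = universe A"
    using inj im by (metis inv_into_image_cancel order_refl)
  moreover have "inj_on ?g (universe B)"
    using im by (simp add: inj_on_inv_into)
  ultimately show ?thesis
    by (simp add: isomorphism_def embedding_def)
qed

lemma isomorphism_image_structure:
  assumes "is_structure L M" and "inj_on f (universe M)"
  shows "isomorphism L f M (image_structure f M)"
proof -
  \<comment> \<open>Since \<open>is_structure\<close> confines the tuples of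
    \<open>interp M R\<close> to the universe, injectivity of \<open>f\<close> there extends to
    \<open>map f\<close> on tuples. Hence a tuple over the universe whose image lies in the image
    relation was in the relation already.\<close>
  have "xs \<in> interp M R"
    if "R \<in> symbols L" "xs \<in> lists (universe M)" "map f xs = map f ys" "ys \<in> interp M R" for R xs ys
  proof -
    have "ys \<in> lists (universe M)"
      using assms(1) that by (auto simp: is_structure_def)
    then have "set xs \<union> set ys \<subseteq> universe M"
      using that(2) by auto
    then have "xs = ys"
      using that(3) assms(2) by (metis inj_on_map_eq_map inj_on_subset)
    then show ?thesis using that by simp
  qed
  then show ?thesis
    using assms unfolding isomorphism_def embedding_def image_structure_def by auto
qed

lemma is_structure_image_structure:
  assumes "is_structure L M"
  shows "is_structure L (image_structure f M)"
  using assms by (fastforce simp: is_structure_def image_structure_def)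

section \<open>Strong amalgamation inside \<open>M\<close>, one-point extensions and self-embeddings
  avoiding finite sets\<close>

lemma restrict_image_in_age:
  assumes M: "is_structure L M" and X: "X \<subseteq> universe M" "finite X"
    and \<iota>: "inj_on \<iota> (universe M)"
  shows "image_structure \<iota> (restrict_structure M X) \<in> age L M"
    and "isomorphism L \<iota> (restrict_structure M X) (image_structure \<iota> (restrict_structure M X))"
proof -
  let ?X = "restrict_structure M X"
  have strX: "is_structure L ?X"
    using M by (rule is_structure_restrict)
  show iso: "isomorphism L \<iota> ?X (image_structure \<iota> ?X)"
    using strX inj_on_subset[OF \<iota> X(1)] by (simp add: isomorphism_image_structure)
  have "embedding L (id \<circ> inv_into (universe ?X) \<iota>) (image_structure \<iota> ?X) M"
    using isomorphism_inv[OF iso] embedding_substructure[OF substructure_restrict[OF X(1)]]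
    unfolding isomorphism_def by (blast intro: embedding_comp)
  then show "image_structure \<iota> ?X \<in> age L M"
    using is_structure_image_structure[OF strX] X(2) by (auto simp: age_def)
qed

text \<open>The age consists of structures on natural numbers, so the three finite substructures are
  coded by an injection of the universe into \<open>nat\<close>, amalgamated there, and the amalgam
  is embedded back into \<open>M\<close>.\<close>

lemma strong_amalgamation_substructures:
  assumes M: "is_structure L M" "countable (universe M)" and SA: "strong_amalgamation L M"
    and X: "X \<subseteq> universe M" "finite X" and Y: "Y \<subseteq> universe M" "finite Y"
    and Z: "Z \<subseteq> universe M" "finite Z"
    and f: "embedding L f (restrict_structure M X) (restrict_structure M Y)"
    and g: "embedding L g (restrict_structure M X) (restrict_structure M Z)"
  obtains h k where "embedding L h (restrict_structure M Y) M"
    and "embedding L k (restrict_structure M Z) M"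
    and "\<And>x. x \<in> X \<Longrightarrow> h (f x) = k (g x)"
    and "h ` Y \<inter> k ` Z = (h \<circ> f) ` X"
proof -
  define \<iota> where "\<iota> = to_nat_on (universe M)"
  have \<iota>: "inj_on \<iota> (universe M)"
    unfolding \<iota>_def using M(2) by (rule inj_on_to_nat_on)
  let ?N = "\<lambda>W. image_structure \<iota> (restrict_structure M W)"
  let ?\<rho> = "inv_into X \<iota>"
  note age = restrict_image_in_age(1)[OF M(1) _ _ \<iota>]
  note iso = restrict_image_in_age(2)[OF M(1) _ _ \<iota>]
  have \<rho>: "embedding L ?\<rho> (?N X) (restrict_structure M X)"
    using isomorphism_inv[OF iso[OF X]] by (simp add: isomorphism_def)
  have \<rho>\<iota>: "?\<rho> (\<iota> x) = x" if "x \<in> X" for x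
    using that inj_on_subset[OF \<iota> X(1)] by simp
  have \<iota>Y: "embedding L \<iota> (restrict_structure M Y) (?N Y)"
    and \<iota>Z: "embedding L \<iota> (restrict_structure M Z) (?N Z)"
    using iso[OF Y] iso[OF Z] by (auto simp: isomorphism_def)
  \<comment> \<open>The maps \<open>f\<close> and \<open>g\<close>, transported to the coded
    structures: decode, apply, encode.\<close>
  have "embedding L (\<iota> \<circ> (f \<circ> ?\<rho>)) (?N X) (?N Y)" "embedding L (\<iota> \<circ> (g \<circ> ?\<rho>)) (?N X) (?N Z)"
    using \<rho> f g \<iota>Y \<iota>Z by (blast intro: embedding_comp)+
  with SA age[OF X] age[OF Y] age[OF Z] obtain C g0 g1 where C: "C \<in> age L M"
    and g0: "embedding L g0 (?N Y) C" and g1: "embedding L g1 (?N Z) C"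
    and eq: "\<forall>x\<in>universe (?N X). g0 ((\<iota> \<circ> (f \<circ> ?\<rho>)) x) = g1 ((\<iota> \<circ> (g \<circ> ?\<rho>)) x)"
    and cap: "g0 ` universe (?N Y) \<inter> g1 ` universe (?N Z)
              = (g0 \<circ> (\<iota> \<circ> (f \<circ> ?\<rho>))) ` universe (?N X)"
    unfolding strong_amalgamation_def by blast
  obtain e where e: "embedding L e C M"
    using C by (auto simp: age_def)
  have e_inj: "inj_on e (universe C)"
    using e by (simp add: embedding_def)
  have sub: "g0 ` \<iota> ` Y \<subseteq> universe C" "g1 ` \<iota> ` Z \<subseteq> universe C"
    using g0 g1 by (auto simp: embedding_def)
  let ?h = "e \<circ> (g0 \<circ> \<iota>)" and ?k = "e \<circ> (g1 \<circ> \<iota>)"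
  have eq': "g0 (\<iota> (f x)) = g1 (\<iota> (g x))" if "x \<in> X" for x
    using eq \<rho>\<iota> that by auto
  \<comment> \<open>Injectivity of \<open>e\<close> on the amalgam lets images commute with
    intersections, so the amalgam stays strong inside \<open>M\<close>.\<close>
  have "?h ` Y \<inter> ?k ` Z = e ` (g0 ` \<iota> ` Y \<inter> g1 ` \<iota> ` Z)"
    using inj_on_image_Int[OF e_inj sub] by (simp add: image_comp comp_assoc)
  also have "g0 ` \<iota> ` Y \<inter> g1 ` \<iota> ` Z = (\<lambda>x. g0 (\<iota> (f x))) ` X"
    using cap \<rho>\<iota> by (simp add: image_image cong: image_cong_simp)
  finally have "?h ` Y \<inter> ?k ` Z = (?h \<circ> f) ` X"
    by (simp add: image_image)
  moreover have "embedding L ?h (restrict_structure M Y) M" "embedding L ?k (restrict_structure M Z) M"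
    using \<iota>Y \<iota>Z g0 g1 e by (blast intro: embedding_comp)+
  ultimately show ?thesis
    using that[of ?h ?k] eq' by simp
qed

text \<open>The forbidden points are added to the image of \<open>f\<close>, and the result is
  amalgamated over \<open>X\<close> with the one-point extension. Strongness separates the new point
  from all of them. Ultrahomogeneity then supplies an automorphism that moves the amalgamated copy
  of \<open>Y\<close> back to \<open>Y\<close>, so that the values of \<open>f\<close> are
  restored.\<close>

lemma one_point_extension_avoiding:
  assumes fr: "relational_fraisse_structure L M" and SA: "strong_amalgamation L M"
    and X: "X \<subseteq> universe M" "finite X" and y: "y \<in> universe M" "y \<notin> X" and F: "finite F"
    and f: "embedding L f (restrict_structure M X) M"
  obtains z where "z \<notin> F" and "embedding L (f(y := z)) (restrict_structure M (insert y X)) M"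
proof -
  have M: "is_structure L M" "countable (universe M)" and uh: "ultrahomogeneous L M"
    using fr by (auto simp: relational_fraisse_structure_def)
  \<comment> \<open>Points of \<open>F\<close> outside the universe are no values of an embedding
    into \<open>M\<close>, so only those in \<open>universe M\<close> have to be avoided.\<close>
  define Y where "Y = f ` X \<union> (F \<inter> universe M)"
  have fX: "f ` X \<subseteq> universe M"
    using f by (simp add: embedding_def)
  have Y: "Y \<subseteq> universe M" "finite Y"
    using fX X F by (auto simp: Y_def)
  have Z: "insert y X \<subseteq> universe M" "finite (insert y X)"
    using X y by auto
  have "embedding L f (restrict_structure M X) (restrict_structure M Y)"
    using f unfolding embedding_def restrict_structure_def Y_def by auto
  moreover have "embedding L id (restrict_structure M X) (restrict_structure M (insert y X))"
    unfolding embedding_def restrict_structure_def by auto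
  ultimately obtain h k where h: "embedding L h (restrict_structure M Y) M"
    and k: "embedding L k (restrict_structure M (insert y X)) M"
    and hk: "\<And>x. x \<in> X \<Longrightarrow> h (f x) = k (id x)"
    and cap: "h ` Y \<inter> k ` insert y X = (h \<circ> f) ` X"
    using strong_amalgamation_substructures[OF M SA X Y Z] by metis
  let ?hY = "restrict_structure M (h ` Y)"
  have h_inj: "inj_on h Y" and hY: "h ` Y \<subseteq> universe M"
    using h by (auto simp: embedding_def)
  have "isomorphism L (inv_into Y h) ?hY (restrict_structure M Y)"
    using isomorphism_inv[OF isomorphism_onto_image[OF h]] by simp
  \<comment> \<open>The inverse of \<open>h\<close> is an isomorphism between finite substructures;
    \<open>g\<close> is an automorphism extending it.\<close>
  then obtain g where g: "isomorphism L g M M" and g_eq: "\<And>x. x \<in> h ` Y \<Longrightarrow> g x = inv_into Y h x"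
    using uh substructure_restrict[OF hY] substructure_restrict[OF Y(1)] Y(2)
    unfolding ultrahomogeneous_def by (metis finite_imageI universe_restrict_structure)
  have gh: "g (h u) = u" if "u \<in> Y" for u
    using g_eq h_inj that by simp
  have gk: "embedding L (g \<circ> k) (restrict_structure M (insert y X)) M"
    using g k unfolding isomorphism_def by (blast intro: embedding_comp)
  have "g (k y) \<notin> F"
  proof
    assume "g (k y) \<in> F"
    moreover have "g (k y) \<in> universe M"
      using gk by (auto simp: embedding_def)
    ultimately have "g (k y) \<in> Y"
      by (simp add: Y_def)
    then have "g (k y) = g (h (g (k y)))" "h (g (k y)) \<in> h ` Y"
      by (simp_all add: gh)
    moreover have "inj_on g (universe M)" "k y \<in> universe M"
      using g k by (auto simp: isomorphism_def embedding_def)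
    ultimately have "k y \<in> h ` Y"
      using hY by (metis inj_onD subsetD)
    then have "k y \<in> (h \<circ> f) ` X"
      using cap by auto
    then obtain x where "x \<in> X" "k y = k x"
      using hk by auto
    moreover have "inj_on k (insert y X)"
      using k by (simp add: embedding_def)
    ultimately show False
      using y(2) by (metis inj_onD insertCI)
  qed
  moreover have gk_eq: "(g \<circ> k) x = (f(y := g (k y))) x" if "x \<in> insert y X" for x
    using that hk[of x] gh[of "f x"] by (auto simp: Y_def)
  have "embedding L (f(y := g (k y))) (restrict_structure M (insert y X)) M"
    using gk by (rule embedding_cong) (simp only: universe_restrict_structure gk_eq)
  ultimately show ?thesis
    using that by blast
qed

text \<open>The points are placed one after another by one-point extensions, each outside the finite
  set that \<open>bad\<close> assigns to the images chosen before. Every condition on an embedding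
  concerns finitely many points, so the limit of the stages is an embedding. No surjectivity is
  sought, hence there is no back step.\<close>

lemma self_embedding_avoiding:
  assumes fr: "relational_fraisse_structure L M" and SA: "strong_amalgamation L M"
    and bad: "\<And>X. X \<subseteq> universe M \<Longrightarrow> finite X \<Longrightarrow> finite (bad X)"
    and a: "bij_betw a (UNIV :: nat set) (universe M)"
  obtains e where "embedding L e M M" and "\<And>n. e (a n) \<notin> bad (e ` a ` {..<n})"
proof -
  have aU: "a n \<in> universe M" and a_eq: "a i = a j \<longleftrightarrow> i = j" for n i j
    using a by (auto simp: bij_betw_def inj_on_def)
  \<comment> \<open>Stage \<open>n\<close> is a total function of which only the values at
    \<open>a 0, ..., a (n - 1)\<close> matter. By \<open>?Q\<close> a stage differs from the next at
    most at \<open>a n\<close>, which makes the stages coherent.\<close>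
  let ?P = "\<lambda>n f. embedding L f (restrict_structure M (a ` {..<n})) M"
  let ?Q = "\<lambda>n f g. \<exists>z. g = f(a n := z) \<and> z \<notin> bad (f ` a ` {..<n})"
  have "\<exists>f. \<forall>n. ?P n (f n) \<and> ?Q n (f n) (f (Suc n))"
  proof (rule dependent_nat_choice)
    show "\<exists>f. ?P 0 f"
      using embedding_restrict[OF embedding_id] by auto
  next
    fix f n
    assume f: "?P n f"
    have "f ` a ` {..<n} \<subseteq> universe M"
      using f by (simp add: embedding_def)
    then have "finite (bad (f ` a ` {..<n}))"
      by (intro bad) auto
    moreover have "a ` {..<n} \<subseteq> universe M" "finite (a ` {..<n})" "a n \<notin> a ` {..<n}"
      using aU by (auto simp: a_eq)
    ultimately obtain z where z: "z \<notin> bad (f ` a ` {..<n})"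
      and "embedding L (f(a n := z)) (restrict_structure M (insert (a n) (a ` {..<n}))) M"
      by (elim one_point_extension_avoiding[OF fr SA _ _ aU _ _ f])
    moreover have "insert (a n) (a ` {..<n}) = a ` {..<Suc n}"
      by (simp add: lessThan_Suc)
    ultimately have "?P (Suc n) (f(a n := z))"
      by simp
    with z show "\<exists>g. ?P (Suc n) g \<and> ?Q n f g"
      by blast
  qed
  then obtain f where P: "\<And>n. ?P n (f n)" and Q: "\<And>n. ?Q n (f n) (f (Suc n))"
    by blast
  \<comment> \<open>The value at \<open>a n\<close> is chosen on passing from stage \<open>n\<close>
    to stage \<open>Suc n\<close>, so stage \<open>Suc n\<close> is the first to read it
    from.\<close>
  define e where "e x = f (Suc (inv a x)) x" for x
  have inv_a: "inv a (a n) = n" for n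
    by (rule inv_f_f) (simp add: inj_def a_eq)
  have stable: "f n (a i) = e (a i)" if "i < n" for i n
    using that
  proof (induction n)
    case (Suc n)
    show ?case
    proof (cases "i = n")
      case True
      then show ?thesis by (simp add: e_def inv_a)
    next
      case False
      obtain z where "f (Suc n) = (f n)(a n := z)"
        using Q[of n] by blast
      then show ?thesis
        using Suc False by (simp add: a_eq)
    qed
  qed simp
  have e_fin: "embedding L e (restrict_structure M (a ` {..<n})) M" for n
    by (rule embedding_cong[OF P[of n]]) (auto simp: stable)
  \<comment> \<open>Every finite set of points lies in an initial segment of the enumeration, where
    \<open>e\<close> agrees with a single stage.\<close>
  have cover: "\<exists>n. X \<subseteq> a ` {..<n}" if "finite X" "X \<subseteq> universe M" for X
  proof -
    have "finite (inv a ` X)"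
      using that(1) by simp
    then obtain n where n: "\<forall>i\<in>inv a ` X. i < n"
      using finite_nat_set_iff_bounded by blast
    have "x \<in> a ` {..<n}" if "x \<in> X" for x
    proof -
      have "x \<in> range a"
        using \<open>x \<in> X\<close> \<open>X \<subseteq> universe M\<close> a by (auto simp: bij_betw_def)
      then have "x = a (inv a x)"
        by (simp add: f_inv_into_f)
      then show ?thesis
        using n \<open>x \<in> X\<close> by blast
    qed
    then show ?thesis by blast
  qed
  have "embedding L e M M"
    unfolding embedding_def
  proof (intro conjI ballI impI)
    show "e ` universe M \<subseteq> universe M"
    proof (rule image_subsetI)
      fix x
      assume "x \<in> universe M"
      then obtain n where "{x} \<subseteq> a ` {..<n}"
        using cover[of "{x}"] by auto
      then show "e x \<in> universe M"
        using e_fin[of n] by (auto simp: embedding_def)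
    qed
    show "inj_on e (universe M)"
    proof (rule inj_onI)
      fix x y
      assume xy: "x \<in> universe M" "y \<in> universe M" "e x = e y"
      then obtain n where "{x, y} \<subseteq> a ` {..<n}"
        using cover[of "{x, y}"] by auto
      moreover have "inj_on e (a ` {..<n})"
        using e_fin[of n] by (simp add: embedding_def)
      ultimately show "x = y"
        using xy(3) by (meson inj_onD insert_subset)
    qed
  next
    fix R xs
    assume R: "R \<in> symbols L" "xs \<in> lists (universe M)" "length xs = arity L R"
    then obtain n where "set xs \<subseteq> a ` {..<n}"
      using cover[of "set xs"] by auto
    then have "xs \<in> lists (a ` {..<n})"
      by auto
    moreover from this have "xs \<in> interp M R \<longleftrightarrow> xs \<in> interp (restrict_structure M (a ` {..<n})) R"
      by (simp add: restrict_structure_def)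
    ultimately show "xs \<in> interp M R \<longleftrightarrow> map e xs \<in> interp M R"
      using e_fin[of n] R unfolding embedding_def by simp
  qed
  moreover have "e (a n) \<notin> bad (e ` a ` {..<n})" for n
  proof -
    have "f n ` a ` {..<n} = e ` a ` {..<n}"
      by (auto simp: stable image_image intro!: image_cong)
    moreover have "f (Suc n) (a n) = e (a n)"
      by (simp add: stable)
    ultimately show ?thesis
      using Q[of n] by auto
  qed
  ultimately show ?thesis
    using that by blast
qed

section \<open>The point-Ramsey property for self-embeddings and for finitely many
  colourings\<close>

lemma canonical_point_ramsey_self_embedding:
  fixes \<chi> :: "'a \<Rightarrow> 'c"
  assumes "canonical_infinite_point_ramsey L M" and "countable (universe M)"
  obtains g where "embedding L g M M"
    and "(\<exists>p. \<forall>x\<in>universe M. \<chi> (g x) = p) \<or> inj_on (\<chi> \<circ> g) (universe M)"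
proof -
  \<comment> \<open>Only countably many colours occur on the universe; coding them injectively by
    natural numbers changes neither constancy nor injectivity.\<close>
  let ?c = "to_nat_on (\<chi> ` universe M)"
  have c_inj: "inj_on ?c (\<chi> ` universe M)"
    using assms(2) by (intro inj_on_to_nat_on countable_image)
  obtain N f where N: "substructure L N M" and f: "isomorphism L f N M"
    and col: "(\<exists>c. \<forall>x\<in>universe N. (?c \<circ> \<chi>) x = c) \<or> inj_on (?c \<circ> \<chi>) (universe N)"
    using assms(1) unfolding canonical_infinite_point_ramsey_def isomorphic_def by metis
  have NM: "universe N \<subseteq> universe M"
    using N by (simp add: substructure_def)
  have col': "(\<exists>p. \<forall>x\<in>universe N. \<chi> x = p) \<or> inj_on \<chi> (universe N)"
    using col
  proof
    assume "\<exists>c. \<forall>x\<in>universe N. (?c \<circ> \<chi>) x = c"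
    then obtain c where c: "\<forall>x\<in>universe N. ?c (\<chi> x) = c"
      by auto
    have "\<chi> x = \<chi> y" if "x \<in> universe N" "y \<in> universe N" for x y
      using inj_onD[OF c_inj, of "\<chi> x" "\<chi> y"] c that NM by auto
    then show ?thesis by blast
  qed (auto intro: inj_on_imageI2)
  \<comment> \<open>The copy \<open>N\<close> is turned into a self-embedding of \<open>M\<close>
    with image \<open>universe N\<close>, since self-embeddings can be composed.\<close>
  let ?g = "inv_into (universe N) f"
  have g: "isomorphism L ?g M N"
    using f by (rule isomorphism_inv)
  then have gN: "?g ` universe M = universe N" and g_inj: "inj_on ?g (universe M)"
    by (auto simp: isomorphism_def embedding_def)
  have "embedding L (id \<circ> ?g) M M"
    using g embedding_substructure[OF N] unfolding isomorphism_def by (blast intro: embedding_comp)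
  moreover have "(\<exists>p. \<forall>x\<in>universe M. \<chi> (?g x) = p) \<or> inj_on (\<chi> \<circ> ?g) (universe M)"
    using col' gN g_inj by (auto intro: comp_inj_on)
  ultimately show ?thesis
    using that[of ?g] by simp
qed

text \<open>Being constant and being injective both survive composition with a further
  self-embedding. The colourings can therefore be treated in turn, each pulled back along the
  self-embedding found so far.\<close>

lemma canonical_point_ramsey_finitely_many_colourings:
  fixes d :: "nat \<Rightarrow> 'a \<Rightarrow> 'c"
  assumes "canonical_infinite_point_ramsey L M" and "countable (universe M)"
  shows "\<exists>e. embedding L e M M \<and>
    (\<forall>j<n. (\<exists>p. \<forall>x\<in>universe M. d j (e x) = p) \<or> inj_on (d j \<circ> e) (universe M))"
proof (induction n)
  case 0
  show ?case
    using embedding_id by auto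
next
  case (Suc n)
  then obtain e where e: "embedding L e M M"
    and IH: "\<And>j. j < n \<Longrightarrow>
      (\<exists>p. \<forall>x\<in>universe M. d j (e x) = p) \<or> inj_on (d j \<circ> e) (universe M)"
    by blast
  obtain g where g: "embedding L g M M"
    and col: "(\<exists>p. \<forall>x\<in>universe M. (d n \<circ> e) (g x) = p) \<or> inj_on (d n \<circ> e \<circ> g) (universe M)"
    using canonical_point_ramsey_self_embedding[OF assms] by blast
  have gM: "g ` universe M \<subseteq> universe M" and g_inj: "inj_on g (universe M)"
    using g by (auto simp: embedding_def)
  have "(\<exists>p. \<forall>x\<in>universe M. d j ((e \<circ> g) x) = p) \<or> inj_on (d j \<circ> (e \<circ> g)) (universe M)"
    if "j < Suc n" for j
  proof (cases "j = n")
    case True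
    then show ?thesis
      using col by (simp add: comp_assoc)
  next
    case False
    then have "j < n"
      using that by simp
    from IH[OF this] show ?thesis
    proof
      assume "inj_on (d j \<circ> e) (universe M)"
      then have "inj_on (d j \<circ> e \<circ> g) (universe M)"
        using g_inj gM by (meson comp_inj_on inj_on_subset)
      then show ?thesis
        by (simp add: comp_assoc)
    qed (use gM in auto)
  qed
  then show ?case
    using embedding_comp[OF g e] by blast
qed

section \<open>From the point-Ramsey property to sunflowers\<close>

lemma canonical_point_ramsey_imp_sunflower:
  fixes L :: "'r language" and M :: "('a, 'r) rel_structure"
  assumes fr: "relational_fraisse_structure L M" and SA: "strong_amalgamation L M"
    and ram: "canonical_infinite_point_ramsey L M"
  shows "infinite_k_sunflower_property TYPE('u::infinite) k L M"
  unfolding infinite_k_sunflower_property_def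
proof (intro allI impI)
  fix M' :: "('u set, 'r) rel_structure"
  assume M': "is_structure L M' \<and> structure_on_sets k M' \<and> isomorphic L M' M"
  let ?U = "universe M"
  have count: "countable ?U" and inf: "infinite ?U"
    using fr by (auto simp: relational_fraisse_structure_def)
  obtain v where v: "isomorphism L v M M'"
    using M' isomorphism_inv unfolding isomorphic_def by blast
  then have vU: "finite (v x) \<and> card (v x) = k" if "x \<in> ?U" for x
    using M' that unfolding structure_on_sets_def isomorphism_def by blast
  \<comment> \<open>Each \<open>k\<close>-set is enumerated by \<open>{..<k}\<close> in an arbitrary
    way; for fixed \<open>j\<close>, the \<open>j\<close>-th entry is then a colouring of the points
    of \<open>M\<close>.\<close>
  have "\<forall>x\<in>?U. \<exists>h. bij_betw h {..<k} (v x)"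
    using vU by (metis ex_bij_betw_nat_finite lessThan_atLeast0)
  then obtain d' where d': "\<forall>x\<in>?U. bij_betw (d' x) {..<k} (v x)"
    by metis
  obtain e where e: "embedding L e M M" and col: "\<And>j. j < k \<Longrightarrow>
      (\<exists>p. \<forall>x\<in>?U. d' (e x) j = p) \<or> inj_on ((\<lambda>x. d' x j) \<circ> e) ?U"
    using canonical_point_ramsey_finitely_many_colourings[OF ram count, of k "\<lambda>j x. d' x j"] by blast
  define w where "w = v \<circ> e"
  define d where "d j x = d' (e x) j" for j x
  have d_col: "(\<exists>p. \<forall>x\<in>?U. d j x = p) \<or> inj_on (d j) ?U" if "j < k" for j
  proof -
    have "d j = (\<lambda>x. d' x j) \<circ> e"
      by (simp add: fun_eq_iff d_def)
    then show ?thesis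
      using col[OF that] by simp
  qed
  have eU: "e ` ?U \<subseteq> ?U"
    using e by (simp add: embedding_def)
  have w: "embedding L w M M'"
    unfolding w_def using e v by (auto simp: isomorphism_def intro: embedding_comp)
  have w_d: "w x = (\<lambda>j. d j x) ` {..<k}" if "x \<in> ?U" for x
    using d' eU that by (auto simp: w_def d_def bij_betw_def)
  \<comment> \<open>The constant entries, which will be the kernel.\<close>
  define c where "c = {p. \<exists>j<k. \<forall>x\<in>?U. d j x = p}"
  have c_w: "c \<subseteq> w x" if "x \<in> ?U" for x
    using that by (auto simp: c_def w_d)
  \<comment> \<open>The points \<open>y\<close> whose set meets a set over \<open>X\<close> in an
    injective entry. For finite \<open>X\<close> there are finitely many: the union of the sets is
    finite, and each injective \<open>d j\<close> takes each of its values once.\<close>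
  define bad where "bad X = {y \<in> ?U. \<exists>j<k. inj_on (d j) ?U \<and> d j y \<in> \<Union>(w ` X)}" for X
  have "finite (bad X)" if X: "X \<subseteq> ?U" "finite X" for X
  proof -
    have "finite (\<Union>(w ` X))"
      using X by (auto simp: w_d subsetD)
    then have "finite (d j -` \<Union>(w ` X) \<inter> ?U)" if "inj_on (d j) ?U" for j
      using that by (rule finite_vimage_IntI)
    then have "finite (\<Union>j\<in>{j. j < k \<and> inj_on (d j) ?U}. d j -` \<Union>(w ` X) \<inter> ?U)"
      by (intro finite_UN_I) simp_all
    then show ?thesis
      by (rule finite_subset[rotated]) (auto simp: bad_def)
  qed
  moreover have a: "bij_betw (from_nat_into ?U) UNIV ?U"
    using count inf by (rule bij_betw_from_nat_into)
  ultimately obtain f where f: "embedding L f M M"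
    and f_bad: "\<And>n. f (from_nat_into ?U n) \<notin> bad (f ` from_nat_into ?U ` {..<n})"
    using self_embedding_avoiding[OF fr SA] by blast
  have fU: "f x \<in> ?U" if "x \<in> ?U" for x
    using f that by (auto simp: embedding_def)
  have aU: "from_nat_into ?U n \<in> ?U" for n
    using a by (auto simp: bij_betw_def)
  \<comment> \<open>The construction only makes later points avoid earlier ones; \<open>disj\<close>
    follows because intersection is symmetric.\<close>
  have ordered: "w (f (from_nat_into ?U i)) \<inter> w (f (from_nat_into ?U n)) = c" if "i < n" for i n
  proof -
    let ?x = "f (from_nat_into ?U i)" and ?y = "f (from_nat_into ?U n)"
    have xy: "?x \<in> ?U" "?y \<in> ?U"
      using fU aU by auto
    \<comment> \<open>The common point \<open>p\<close> is an entry \<open>d j ?y\<close>. If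
      \<open>d j\<close> were injective, then \<open>?y\<close> would be bad for the earlier images,
      which include \<open>?x\<close>; so \<open>d j\<close> is constant.\<close>
    have "p \<in> c" if p: "p \<in> w ?x" "p \<in> w ?y" for p
    proof -
      obtain j where j: "j < k" "p = d j ?y"
        using p(2) xy w_d by auto
      then have "\<not> inj_on (d j) ?U"
        using f_bad[of n] p(1) xy \<open>i < n\<close> by (auto simp: bad_def)
      then show ?thesis
        using d_col[OF j(1)] j xy by (auto simp: c_def)
    qed
    then show ?thesis
      using c_w xy by blast
  qed
  have disj: "w (f x) \<inter> w (f y) = c" if xy: "x \<in> ?U" "y \<in> ?U" "x \<noteq> y" for x y
  proof -
    obtain i n where "x = from_nat_into ?U i" "y = from_nat_into ?U n" "i \<noteq> n"
      using a xy unfolding bij_betw_def by (metis imageE)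
    then show ?thesis
      using ordered[of i n] ordered[of n i] by (cases "i < n") auto
  qed
  let ?S = "restrict_structure M' ((w \<circ> f) ` ?U)"
  have wf: "embedding L (w \<circ> f) M M'"
    using f w by (rule embedding_comp)
  then have "substructure L ?S M'"
    by (intro substructure_restrict) (simp add: embedding_def)
  moreover have "isomorphic L ?S M"
    using isomorphism_inv[OF isomorphism_onto_image[OF wf]] unfolding isomorphic_def by blast
  moreover have "structured_sunflower ?S"
    unfolding structured_sunflower_def using disj by (intro exI[of _ c]) auto
  ultimately show "\<exists>S. substructure L S M' \<and> structured_sunflower S \<and> isomorphic L S M"
    by blast
qed

section \<open>From 2-sunflowers to the point-Ramsey property\<close>

lemma two_sunflower_imp_canonical_point_ramsey:
  fixes L :: "'r language" and M :: "('a, 'r) rel_structure"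
  assumes fr: "relational_fraisse_structure L M"
    and sun: "infinite_k_sunflower_property TYPE('u::infinite) 2 L M"
  shows "canonical_infinite_point_ramsey L M"
  unfolding canonical_infinite_point_ramsey_def
proof
  fix \<chi> :: "'a \<Rightarrow> nat"
  let ?U = "universe M"
  have M: "is_structure L M" and count: "countable ?U" and inf: "infinite ?U"
    using fr by (auto simp: relational_fraisse_structure_def)
  obtain q :: "nat \<Rightarrow> 'u" where "inj q"
    using infinite_countable_subset[OF infinite_UNIV] by blast
  then have q: "q i = q j \<longleftrightarrow> i = j" for i j
    by (simp add: inj_eq)
  \<comment> \<open>Even indices code points of \<open>M\<close> and odd indices code colours. The
    two kinds never coincide, so each \<open>t x\<close> has two elements and \<open>t\<close> is
    injective even where colours agree.\<close>
  define pt where "pt x = q (2 * to_nat_on ?U x)" for x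
  define cl where "cl n = q (2 * n + 1)" for n
  have pt_eq: "pt x = pt y \<longleftrightarrow> x = y" if "x \<in> ?U" "y \<in> ?U" for x y
    using count that by (simp add: pt_def q)
  have cl_eq: "cl m = cl n \<longleftrightarrow> m = n" for m n
    by (simp add: cl_def q)
  have pt_cl: "pt x \<noteq> cl n" for x n
    unfolding pt_def cl_def q by presburger
  define t where "t x = {pt x, cl (\<chi> x)}" for x
  have t_inj: "inj_on t ?U"
    by (rule inj_onI) (metis doubleton_eq_iff pt_cl pt_eq t_def)
  let ?M' = "image_structure t M"
  have t: "isomorphism L t M ?M'"
    using M t_inj by (rule isomorphism_image_structure)
  have "structure_on_sets 2 ?M'"
    using pt_cl by (auto simp: structure_on_sets_def t_def)
  moreover have "isomorphic L ?M' M"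
    using isomorphism_inv[OF t] unfolding isomorphic_def by blast
  ultimately obtain S f where S: "substructure L S ?M'" and sf: "structured_sunflower S"
    and f: "isomorphism L f S M"
    using sun is_structure_image_structure[OF M]
    unfolding infinite_k_sunflower_property_def isomorphic_def by metis
  \<comment> \<open>First \<open>M\<close> is mapped onto the sunflower \<open>S\<close>, then each
    pair is decoded to its point. The image of \<open>?r\<close> is the desired copy.\<close>
  let ?r = "inv_into ?U t \<circ> inv_into (universe S) f"
  have r: "embedding L ?r M M"
  proof -
    have "embedding L (inv_into (universe S) f) M S" "embedding L (inv_into ?U t) ?M' M"
      using isomorphism_inv[OF f] isomorphism_inv[OF t] by (auto simp: isomorphism_def)
    then have "embedding L (inv_into ?U t \<circ> (id \<circ> inv_into (universe S) f)) M M"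
      using embedding_substructure[OF S] by (blast intro: embedding_comp)
    then show ?thesis by simp
  qed
  let ?X = "?r ` ?U"
  let ?N = "restrict_structure M ?X"
  have XU: "?X \<subseteq> ?U"
    using r by (simp add: embedding_def)
  have iso: "isomorphism L ?r M ?N"
    using r by (rule isomorphism_onto_image)
  have X_inf: "infinite ?X"
    using inf r unfolding embedding_def by (blast dest: finite_imageD)
  have tX: "t x \<in> universe S" if x: "x \<in> ?X" for x
  proof -
    obtain y where y: "y \<in> ?U" "x = ?r y"
      using x by blast
    have "f ` universe S = ?U"
      using f by (simp add: isomorphism_def)
    then have 1: "inv_into (universe S) f y \<in> universe S"
      using y(1) by (simp add: inv_into_into)
    then have "inv_into (universe S) f y \<in> t ` ?U"
      using S by (auto simp: substructure_def)
    then show ?thesis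
      using 1 y(2) by (simp add: f_inv_into_f)
  qed
  obtain c where c: "\<And>x y. x \<in> ?X \<Longrightarrow> y \<in> ?X \<Longrightarrow> x \<noteq> y \<Longrightarrow> t x \<inter> t y = c"
    using sf tX t_inj XU unfolding structured_sunflower_def by (metis inj_onD subsetD)
  have "(\<exists>n. \<forall>x\<in>?X. \<chi> x = n) \<or> inj_on \<chi> ?X"
  proof (cases "\<exists>n. cl n \<in> c")
    case True
    then obtain n where n: "cl n \<in> c" by blast
    have "\<chi> x = n" if "x \<in> ?X" for x
    proof -
      \<comment> \<open>The kernel is only known as an intersection of two distinct petals, so a
        second point of the copy is required to conclude that it lies in \<open>t x\<close>.\<close>
      obtain y where "y \<in> ?X" "y \<noteq> x"
        using X_inf by (metis finite.simps infinite_super insertCI subsetI)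
      then have "cl n \<in> t x"
        using c[of x y] n that by blast
      then show ?thesis
        using pt_cl[of x n] by (auto simp: t_def cl_eq)
    qed
    then show ?thesis by blast
  next
    case False
    have "x = y" if "x \<in> ?X" "y \<in> ?X" "\<chi> x = \<chi> y" for x y
    proof (rule ccontr)
      assume "x \<noteq> y"
      \<comment> \<open>Two distinct points of the same colour share the code of that colour, which
        would put it into the kernel.\<close>
      then have "cl (\<chi> x) \<in> c"
        using c[OF that(1,2)] that(3) by (auto simp: t_def)
      then show False
        using False by blast
    qed
    then show ?thesis
      by (blast intro: inj_onI)
  qed
  moreover have "isomorphic L ?N M"
    using isomorphism_inv[OF iso] unfolding isomorphic_def by blast
  ultimately show "\<exists>N. substructure L N M \<and> isomorphic L N M \<and>
      ((\<exists>c. \<forall>x\<in>universe N. \<chi> x = c) \<or> inj_on \<chi> (universe N))"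
    using substructure_restrict[OF XU] by (intro exI[of _ ?N]) simp
qed

theorem theoremA:
  fixes L :: "'r language" and M :: "('a, 'r) rel_structure"
  assumes "relational_fraisse_structure L M"
    and "strong_amalgamation L M"
  shows "(infinite_sunflower_property TYPE('u::infinite) L M \<longleftrightarrow>
            infinite_k_sunflower_property TYPE('u) 2 L M) \<and>
         (infinite_k_sunflower_property TYPE('u) 2 L M \<longleftrightarrow>
            canonical_infinite_point_ramsey L M)"
proof -
  have "infinite_k_sunflower_property TYPE('u) 2 L M"
    if "infinite_sunflower_property TYPE('u) L M"
    using that by (simp add: infinite_sunflower_property_def)
  moreover have "infinite_sunflower_property TYPE('u) L M"
    if "canonical_infinite_point_ramsey L M"
    unfolding infinite_sunflower_property_def
    using canonical_point_ramsey_imp_sunflower[OF assms that] by blast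
  ultimately show ?thesis
    using two_sunflower_imp_canonical_point_ramsey[OF assms(1)] by blast
qed

end
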